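(* Let $B$ be a cubic graph and let $G$ be obtained by replacing every vertex $x$ of $B$ by a vertex gadget $H_x$. Then every cycle of $G$ either lies inside a single gadget copy, or projects onto a cycle $x_1x_2\cdots x_\ell$ of $B$ and has length $\ell+\sum_{i=1}^{\ell}s_i$ with $s_i\in S_{H_{x_i}}(p_i,q_i)$ for each $i$, where $p_i,q_i$ are the attachments of $H_{x_i}$ facing $x_{i-1}$ and $x_{i+1}$ respectively (indices modulo $\ell$). Conversely, for every cycle $x_1\cdots x_\ell$ of $B$, with $p_i,q_i$ as described, and every choice of $s_i\in S_{H_{x_i}}(p_i,q_i)$, the number $\ell+\sum_{i=1}^{\ell}s_i$ is the length of a cycle of $G$. In particular, $G$ has a cycle of length $T$ if and only if some gadget $H_x$ has an internal cycle of length $T$, or there is a cycle $x_1\cdots x_\ell$ of $B$ such that $T-\ell$ lies in the Minkowski sum $\sum_{i=1}^{\ell} S_{H_{x_i}}(p_i,q_i)$.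
   Context: Graphs are finite, simple and undirected; cycles and paths are simple. A vertex gadget is a graph $H$ with three distinguished vertices of degree $2$, called attachments, all other vertices of $H$ having degree $3$. Replacing a vertex $x$ of a cubic graph $B$ by $H$ means deleting $x$ and joining its three former neighbours to the three attachments of (a copy of) $H$ by a bijection; the attachment assigned to the neighbour $y$ is said to face $y$ (or to face the edge $xy$). When all vertices of $B$ are replaced, $G$ consists of disjoint copies of the gadgets $H_x$, $x\in V(B)$, together with, for each edge $xy$ of $B$, one edge joining the attachment of $H_x$ facing $y$ to the attachment of $H_y$ facing $x$. For attachments $p,q$ of $H$, $S_H(p,q)$ denotes the set of lengths (numbers of edges) of simple $p$–$q$ paths in $H$. The projection of a cycle of $G$ to $B$ is obtained by contracting each gadget copy $H_x$ to the vertex $x$. The Minkowski sum of sets of integers $S_1,\dots,S_\ell$ is $\{s_1+\dots+s_\ell : s_i\in S_i\}$. *)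

theory Defs
  imports Main "HOL-Library.Set_Algebras"
begin

record 'a graph =
  verts :: "'a set"
  edges :: "'a set set"

definition simple_graph :: "'a graph \<Rightarrow> bool" where
  "simple_graph G \<longleftrightarrow> finite (verts G) \<and> (\<forall>e\<in>edges G. e \<subseteq> verts G \<and> card e = 2)"

definition neighbours :: "'a graph \<Rightarrow> 'a \<Rightarrow> 'a set" where
  "neighbours G x = {y. {x, y} \<in> edges G}"

definition degree :: "'a graph \<Rightarrow> 'a \<Rightarrow> nat" where
  "degree G x = card {e \<in> edges G. x \<in> e}"

definition cubic_graph :: "'a graph \<Rightarrow> bool" where
  "cubic_graph G \<longleftrightarrow> simple_graph G \<and> (\<forall>x\<in>verts G. degree G x = 3)"

definition vertex_gadget :: "'b graph \<Rightarrow> 'b set \<Rightarrow> bool" where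
  "vertex_gadget H A \<longleftrightarrow> simple_graph H \<and> A \<subseteq> verts H \<and> card A = 3 \<and>
     (\<forall>u\<in>A. degree H u = 2) \<and> (\<forall>u\<in>verts H - A. degree H u = 3)"

text \<open>Paths and cycles are given by their vertex lists, a cycle without repeating its first vertex
  at the end. So a path has one edge less than the length of its list, while the length of a cycle
  is the length of its list.\<close>

definition is_path :: "'a graph \<Rightarrow> 'a \<Rightarrow> 'a list \<Rightarrow> 'a \<Rightarrow> bool" where
  "is_path G u xs v \<longleftrightarrow> xs \<noteq> [] \<and> hd xs = u \<and> last xs = v \<and> distinct xs \<and>
     set xs \<subseteq> verts G \<and> (\<forall>i. Suc i < length xs \<longrightarrow> {xs ! i, xs ! Suc i} \<in> edges G)"

definition path_lengths :: "'a graph \<Rightarrow> 'a \<Rightarrow> 'a \<Rightarrow> nat set" where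
  "path_lengths G u v = {length xs - 1 | xs. is_path G u xs v}"

definition cycle_graph :: "'a list \<Rightarrow> 'a graph" where
  "cycle_graph xs = \<lparr>verts = set xs,
     edges = {{xs ! i, xs ! (Suc i mod length xs)} | i. i < length xs}\<rparr>"

definition is_cycle :: "'a graph \<Rightarrow> 'a list \<Rightarrow> bool" where
  "is_cycle G xs \<longleftrightarrow> length xs \<ge> 3 \<and> distinct xs \<and>
     verts (cycle_graph xs) \<subseteq> verts G \<and> edges (cycle_graph xs) \<subseteq> edges G"

definition gadget_copy :: "'a \<Rightarrow> 'b graph \<Rightarrow> ('a \<times> 'b) graph" where
  "gadget_copy x H = \<lparr>verts = Pair x ` verts H, edges = (\<lambda>e. Pair x ` e) ` edges H\<rparr>"

text \<open>In the following, \<open>face x y\<close> is the attachment of \<open>H x\<close> facing the neighbour \<open>y\<close> of \<open>x\<close>.\<close>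

definition replace_vertices ::
  "'a graph \<Rightarrow> ('a \<Rightarrow> 'b graph) \<Rightarrow> ('a \<Rightarrow> 'a \<Rightarrow> 'b) \<Rightarrow> ('a \<times> 'b) graph" where
  "replace_vertices B H face = \<lparr>
     verts = (\<Union>x\<in>verts B. verts (gadget_copy x (H x))),
     edges = (\<Union>x\<in>verts B. edges (gadget_copy x (H x))) \<union>
       {{(x, face x y), (y, face y x)} | x y. {x, y} \<in> edges B}\<rparr>"

text \<open>Contraction of every copy \<open>H x\<close> to the vertex \<open>x\<close>, for subgraphs of the graph above: edges
  inside a copy become loops and are dropped. No parallel edges can arise, since each edge of \<open>B\<close>
  comes from only one edge between copies.\<close>

definition projection :: "('a \<times> 'b) graph \<Rightarrow> 'a graph" where
  "projection C = \<lparr>verts = fst ` verts C,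
     edges = {fst ` e | e. e \<in> edges C \<and> card (fst ` e) = 2}\<rparr>"

text \<open>For a cycle \<open>xs\<close> and \<open>i < length xs\<close>, the set of path lengths in the gadget at \<open>xs ! i\<close> between
  the attachments facing the cyclic predecessor and the cyclic successor of \<open>xs ! i\<close>.\<close>

definition traversal_lengths ::
  "('a \<Rightarrow> 'b graph) \<Rightarrow> ('a \<Rightarrow> 'a \<Rightarrow> 'b) \<Rightarrow> 'a list \<Rightarrow> nat \<Rightarrow> nat set" where
  "traversal_lengths H face xs i =
     (let l = length xs; x = xs ! i;
          p = face x (xs ! ((i + l - 1) mod l));
          q = face x (xs ! ((i + 1) mod l))
      in path_lengths (H x) p q)"

end

(* Cut a cycle of G into maximal blocks lying in one gadget copy, after a rotation that makes its
   two ends lie in different copies. A block enters and leaves its copy through attachments, and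
   these differ: an attachment has only one edge leaving the copy, so otherwise the cycle would
   turn back. Two blocks in the same copy would thus use four of its three attachments, so the
   cycle visits each copy at most once and the sequence of visited copies is a cycle of B.
   Conversely, concatenating one path per visited copy gives a cycle. *)

theory Submission
  imports Defs
begin

section \<open>Consecutive pairs of a list\<close>

definition consec :: "'a list \<Rightarrow> ('a \<times> 'a) set" where
  "consec xs = set (zip xs (tl xs))"

text \<open>Zipping with \<open>rotate1 xs\<close> treats the closing pair like all other pairs. A
  one-element list gives a loop and a two-element list gives its pair in both orders; this is what
  later rules out fewer than three blocks.\<close>

definition cyc_consec :: "'a list \<Rightarrow> ('a \<times> 'a) set" where
  "cyc_consec xs = set (zip xs (rotate1 xs))"

lemma consec_Nil [simp]: "consec [] = {}"
  and consec_single [simp]: "consec [a] = {}"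
  and consec_Cons_Cons [simp]: "consec (a # b # xs) = insert (a, b) (consec (b # xs))"
  by (simp_all add: consec_def)

lemma consec_Cons: "xs \<noteq> [] \<Longrightarrow> consec (a # xs) = insert (a, hd xs) (consec xs)"
  by (cases xs) simp_all

lemma consec_conv_nth: "consec xs = {(xs ! i, xs ! Suc i) | i. Suc i < length xs}"
  by (auto simp: consec_def set_zip nth_tl)

lemma consec_append:
  "xs \<noteq> [] \<Longrightarrow> ys \<noteq> [] \<Longrightarrow>
    consec (xs @ ys) = insert (last xs, hd ys) (consec xs \<union> consec ys)"
  by (induction xs rule: induct_list012) (auto simp: consec_Cons)

lemma consec_map: "consec (map f xs) = map_prod f f ` consec xs"
  by (induction xs rule: induct_list012) auto

lemma consec_subset: "consec xs \<subseteq> set xs \<times> set xs"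
  by (induction xs rule: induct_list012) auto

lemma last_concat: "xs \<noteq> [] \<Longrightarrow> last xs \<noteq> [] \<Longrightarrow> last (concat xs) = last (last xs)"
  by (cases xs rule: rev_cases) auto

lemma consec_concat:
  assumes "\<And>b. b \<in> set cs \<Longrightarrow> b \<noteq> []"
  shows "consec (concat cs) = (\<Union>b\<in>set cs. consec b) \<union> (\<lambda>(b, d). (last b, hd d)) ` consec cs"
  using assms
proof (induction cs rule: induct_list012)
  case (3 b d cs)
  have "consec (concat (b # d # cs)) = insert (last b, hd d) (consec b \<union> consec (concat (d # cs)))"
    using consec_append[of b "concat (d # cs)"] 3(3)[of b] 3(3)[of d] by auto
  also have "consec (concat (d # cs)) =
    (\<Union>b\<in>set (d # cs). consec b) \<union> (\<lambda>(b, d). (last b, hd d)) ` consec (d # cs)"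
    using 3 by simp
  finally show ?case by auto
qed auto

lemma cyc_consec_conv_nth:
  "cyc_consec xs = {(xs ! i, xs ! (Suc i mod length xs)) | i. i < length xs}"
  by (auto simp: cyc_consec_def set_zip nth_rotate1)

lemma cyc_consec_conv_consec:
  assumes "xs \<noteq> []"
  shows "cyc_consec xs = insert (last xs, hd xs) (consec xs)"
proof -
  obtain a ys where xs: "xs = a # ys" using assms by (auto simp: neq_Nil_conv)
  \<comment> \<open>The head \<open>b\<close> is decoupled from the appended \<open>a\<close>:
    induction along \<open>ys\<close> changes the head, while the closing element stays
    fixed.\<close>
  have "set (zip (b # ys) (ys @ [a])) = insert (last (b # ys), a) (consec (b # ys))" for b
    by (induction ys arbitrary: b) auto
  then show ?thesis by (simp add: xs cyc_consec_def)
qed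

lemma cyc_consec_map: "cyc_consec (map f xs) = map_prod f f ` cyc_consec xs"
  by (simp add: cyc_consec_def rotate1_map zip_map_map map_prod_def)

lemma cyc_consec_rotate: "cyc_consec (rotate n xs) = cyc_consec xs"
proof (induction n)
  case (Suc n)
  have "cyc_consec (rotate1 ys) = cyc_consec ys" for ys :: "'a list"
  proof (cases ys)
    case (Cons a zs)
    show ?thesis
    proof (cases "zs = []")
      case False
      then show ?thesis
        unfolding Cons
        by (simp add: cyc_consec_conv_consec consec_append consec_Cons insert_commute)
    qed (simp add: Cons)
  qed simp
  then show ?case unfolding rotate_Suc Suc.IH[symmetric] by blast
qed simp

text \<open>This separates the edges of a closed walk that stay within a block from the junctions
  between blocks. The junctions are indexed by the cyclic pairs of the list of blocks, so that this
  list can be treated as a cycle itself.\<close>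

lemma cyc_consec_concat:
  assumes "\<And>b. b \<in> set cs \<Longrightarrow> b \<noteq> []" and "cs \<noteq> []"
  shows "cyc_consec (concat cs) =
    (\<Union>b\<in>set cs. consec b) \<union> (\<lambda>(b, d). (last b, hd d)) ` cyc_consec cs"
proof -
  have "concat cs \<noteq> []" "hd cs \<noteq> []" "last cs \<noteq> []"
    using assms by (auto simp: neq_Nil_conv)
  then show ?thesis
    using assms by (simp add: cyc_consec_conv_consec consec_concat hd_concat last_concat)
qed

lemma cyc_consec_subset: "cyc_consec xs \<subseteq> set xs \<times> set xs"
  by (auto simp: cyc_consec_def dest: set_zip_leftD set_zip_rightD)

section \<open>Predecessors and successors in a cyclic list\<close>

lemma cyc_consec_next: "i < length xs \<Longrightarrow> (xs ! i, xs ! ((i + 1) mod length xs)) \<in> cyc_consec xs"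
  by (auto simp: cyc_consec_conv_nth)

lemma cyc_consec_prev:
  assumes "i < length xs"
  shows "(xs ! ((i + length xs - 1) mod length xs), xs ! i) \<in> cyc_consec xs"
proof -
  \<comment> \<open>Adding the length before subtracting 1 keeps the subtraction of naturals exact
    at \<open>i = 0\<close>.\<close>
  let ?j = "(i + length xs - 1) mod length xs"
  have "Suc ?j mod length xs = Suc (i + length xs - 1) mod length xs"
    by (rule mod_Suc_eq)
  also have "Suc (i + length xs - 1) = i + length xs" using assms by simp
  finally have "Suc ?j mod length xs = i" using assms by simp
  moreover have "?j < length xs" using assms by (intro mod_less_divisor) linarith
  ultimately show ?thesis unfolding cyc_consec_conv_nth by force
qed

text \<open>Distinctness turns equal entries into equal indices. If \<open>p = r\<close>, two steps
  around the list would lead back to the starting index, so the length would divide 2.\<close>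

lemma cyc_consec_no_return:
  assumes "distinct xs" "length xs \<ge> 3" "(p, q) \<in> cyc_consec xs" "(q, r) \<in> cyc_consec xs"
  shows "p \<noteq> r"
proof
  let ?n = "length xs"
  assume "p = r"
  obtain i j where i: "i < ?n" "p = xs ! i" "q = xs ! (Suc i mod ?n)"
    and j: "j < ?n" "q = xs ! j" "r = xs ! (Suc j mod ?n)"
    using assms(3,4) by (auto simp: cyc_consec_conv_nth)
  have "?n > 0" using assms(2) by linarith
  then have "j = Suc i mod ?n" "i = Suc j mod ?n"
    using i j \<open>p = r\<close> assms(1) by (metis mod_less_divisor nth_eq_iff_index_eq)+
  then show False using i(1) j(1) assms(2) by (simp add: mod_Suc split: if_splits)
qed

lemma cyc_consec_const:
  assumes "\<And>a b. (a, b) \<in> cyc_consec xs \<Longrightarrow> f a = f b" "p \<in> set xs"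
  shows "f p = f (hd xs)"
proof -
  have "f (xs ! i) = f (xs ! 0)" if "i < length xs" for i
    using that
  proof (induction i)
    case (Suc i)
    then show ?case using assms(1)[OF cyc_consec_next[of i xs]] by simp
  qed simp
  then show ?thesis using assms(2) by (metis hd_conv_nth in_set_conv_nth list.size(3) not_less0)
qed

text \<open>The blocks grow from the back: a new first element joins the first block if
  \<open>f\<close> agrees there, and otherwise forms a block of its own. Nothing is claimed about
  the junction from the last block to the first; a suitable rotation of the list has to take care of
  it.\<close>

lemma split_into_blocks:
  obtains cs where "concat cs = c" "\<And>b. b \<in> set cs \<Longrightarrow> b \<noteq> []"
    "\<And>b p. b \<in> set cs \<Longrightarrow> p \<in> set b \<Longrightarrow> f p = f (hd b)"
    "\<And>b d. (b, d) \<in> consec cs \<Longrightarrow> f (last b) \<noteq> f (hd d)"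
proof -
  have "\<exists>cs. concat cs = c \<and> (\<forall>b\<in>set cs. b \<noteq> []) \<and>
    (\<forall>b\<in>set cs. \<forall>p\<in>set b. f p = f (hd b)) \<and>
    (\<forall>(b, d)\<in>consec cs. f (last b) \<noteq> f (hd d))"
  proof (induction c)
    case Nil
    show ?case by (intro exI[of _ "[]"]) simp
  next
    case (Cons a c)
    then obtain cs where cs: "concat cs = c" "\<forall>b\<in>set cs. b \<noteq> []"
      "\<forall>b\<in>set cs. \<forall>p\<in>set b. f p = f (hd b)"
      "\<forall>(b, d)\<in>consec cs. f (last b) \<noteq> f (hd d)" by blast
    show ?case
    proof (cases cs)
      case Nil
      then show ?thesis using cs by (intro exI[of _ "[[a]]"]) auto
    next
      case (Cons b bs)
      then have b: "b \<noteq> []" "hd b \<in> set b" using cs(2) by auto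
      show ?thesis
      proof (cases "f a = f (hd b)")
        case True
        have "\<forall>b'\<in>set ((a # b) # bs). \<forall>p\<in>set b'. f p = f (hd b')"
          using cs(3) Cons True by simp
        moreover have "\<forall>(b', d)\<in>consec ((a # b) # bs). f (last b') \<noteq> f (hd d)"
          using cs(4) b Cons by (cases bs) auto
        moreover have "concat ((a # b) # bs) = a # c" "\<forall>b'\<in>set ((a # b) # bs). b' \<noteq> []"
          using cs(1,2) Cons by simp_all
        ultimately show ?thesis by blast
      next
        case False
        have "concat ([a] # cs) = a # c" "\<forall>b'\<in>set ([a] # cs). b' \<noteq> []"
          using cs(1,2) by simp_all
        moreover have "\<forall>b'\<in>set ([a] # cs). \<forall>p\<in>set b'. f p = f (hd b')"
          unfolding list.set ball_simps list.sel using cs(3) by blast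
        moreover have "\<forall>(b', d)\<in>consec ([a] # cs). f (last b') \<noteq> f (hd d)"
          using cs(4) Cons False by simp
        ultimately show ?thesis by blast
      qed
    qed
  qed
  then obtain cs where "concat cs = c" "\<forall>b\<in>set cs. b \<noteq> []"
    "\<forall>b\<in>set cs. \<forall>p\<in>set b. f p = f (hd b)"
    "\<forall>(b, d)\<in>consec cs. f (last b) \<noteq> f (hd d)"
    by (elim exE conjE)
  then show thesis by (intro that[of cs]) (fast | assumption)+
qed

section \<open>Cycles and paths in terms of consecutive pairs\<close>

lemma cycle_graph_simps [simp]:
  "verts (cycle_graph xs) = set xs"
  "edges (cycle_graph xs) = (\<lambda>(a, b). {a, b}) ` cyc_consec xs"
  by (auto simp: cycle_graph_def cyc_consec_conv_nth)

lemma cycle_graph_rotate: "cycle_graph (rotate n xs) = cycle_graph xs"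
  by (rule graph.equality) (simp_all add: cyc_consec_rotate)

lemma edges_projection_cycle_graph:
  fixes c :: "('a \<times> 'b) list"
  shows "edges (projection (cycle_graph c)) =
    {{fst p, fst q} | p q. (p, q) \<in> cyc_consec c \<and> fst p \<noteq> fst q}"
proof -
  have "edges (projection (cycle_graph c)) =
    {fst ` {p, q} | p q. (p, q) \<in> cyc_consec c \<and> card (fst ` {p, q}) = 2}"
    by (auto simp: projection_def simp del: image_insert image_empty split_paired_Ex split_paired_All)
  moreover have "card (fst ` {p, q}) = 2 \<longleftrightarrow> fst p \<noteq> fst q" for p q :: "'a \<times> 'b"
    by (cases "fst p = fst q") simp_all
  ultimately show ?thesis by (simp only: image_insert image_empty)
qed

lemma is_cycle_iff:
  "is_cycle G xs \<longleftrightarrow> length xs \<ge> 3 \<and> distinct xs \<and> set xs \<subseteq> verts G \<and>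
    (\<forall>a b. (a, b) \<in> cyc_consec xs \<longrightarrow> {a, b} \<in> edges G)"
  by (auto simp: is_cycle_def)

lemma is_cycle_rotate: "is_cycle G (rotate n xs) \<longleftrightarrow> is_cycle G xs"
  by (simp add: is_cycle_def cycle_graph_rotate)

lemma is_path_iff:
  "is_path G u xs v \<longleftrightarrow> xs \<noteq> [] \<and> hd xs = u \<and> last xs = v \<and> distinct xs \<and>
     set xs \<subseteq> verts G \<and> (\<forall>a b. (a, b) \<in> consec xs \<longrightarrow> {a, b} \<in> edges G)"
  by (auto simp: is_path_def consec_conv_nth)

section \<open>Gadget copies and their cycles\<close>

lemma gadget_copy_simps [simp]:
  "verts (gadget_copy x K) = Pair x ` verts K"
  "edges (gadget_copy x K) = (`) (Pair x) ` edges K"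
  by (simp_all add: gadget_copy_def)

lemma Pair_edge_in_gadget_copy [simp]:
  fixes K :: "'b graph"
  shows "{(x, u), (x, v)} \<in> edges (gadget_copy x K) \<longleftrightarrow> {u, v} \<in> edges K"
proof -
  have "{(x, u), (x, v)} = Pair x ` {u, v}" by simp
  \<comment> \<open>Taking images under the injective map \<open>Pair x\<close> is itself injective
    on sets, so an edge of the copy comes from one edge of \<open>K\<close> only.\<close>
  moreover have "inj ((`) (Pair x) :: 'b set \<Rightarrow> _)" by (intro injI) (simp add: inj_image_eq_iff inj_on_def)
  ultimately show ?thesis by (simp add: inj_image_mem_iff del: image_insert)
qed

lemma is_cycle_gadget_copy_map: "is_cycle (gadget_copy x K) (map (Pair x) c) \<longleftrightarrow> is_cycle K c"
proof -
  have "(\<forall>p q. (p, q) \<in> map_prod (Pair x) (Pair x) ` cyc_consec c \<longrightarrow>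
      {p, q} \<in> edges (gadget_copy x K)) \<longleftrightarrow>
    (\<forall>u v. (u, v) \<in> cyc_consec c \<longrightarrow> {(x, u), (x, v)} \<in> edges (gadget_copy x K))"
    by (force simp del: gadget_copy_simps Pair_edge_in_gadget_copy)
  then show ?thesis
    unfolding is_cycle_iff cyc_consec_map Pair_edge_in_gadget_copy
    by (auto simp: distinct_map inj_on_def)
qed

text \<open>Links the two descriptions of an internal cycle: a cycle of \<open>G\<close> is located
  in a copy, whereas the criterion for a length \<open>T\<close> refers to the gadget
  itself.\<close>

lemma ex_is_cycle_gadget_copy:
  "(\<exists>c. is_cycle (gadget_copy x K) c \<and> length c = n) \<longleftrightarrow> (\<exists>c. is_cycle K c \<and> length c = n)"
proof
  assume "\<exists>c. is_cycle (gadget_copy x K) c \<and> length c = n"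
  then obtain c where c: "is_cycle (gadget_copy x K) c" "length c = n" by blast
  then have "fst p = x" if "p \<in> set c" for p
    using that by (auto simp: is_cycle_iff)
  then have "c = map (Pair x) (map snd c)"
    by (simp add: map_idI prod_eq_iff comp_def)
  then show "\<exists>c. is_cycle K c \<and> length c = n"
    using c by (metis is_cycle_gadget_copy_map length_map)
next
  assume "\<exists>c. is_cycle K c \<and> length c = n"
  then show "\<exists>c. is_cycle (gadget_copy x K) c \<and> length c = n"
    by (metis is_cycle_gadget_copy_map length_map)
qed

section \<open>Cycles of the replacement graph\<close>

locale replacement =
  fixes B :: "'a graph"
    and H :: "'a \<Rightarrow> 'b graph"
    and A :: "'a \<Rightarrow> 'b set"
    and face :: "'a \<Rightarrow> 'a \<Rightarrow> 'b"
    and G :: "('a \<times> 'b) graph"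
  assumes cubic: "cubic_graph B"
    and gadget: "\<And>x. x \<in> verts B \<Longrightarrow> vertex_gadget (H x) (A x)"
    and face_bij: "\<And>x. x \<in> verts B \<Longrightarrow> bij_betw (face x) (neighbours B x) (A x)"
    and G_def: "G = replace_vertices B H face"
begin

section \<open>Vertices and edges of the replacement graph\<close>

lemma edge_verts: "{x, y} \<in> edges B \<Longrightarrow> x \<in> verts B \<and> y \<in> verts B"
  using cubic by (fastforce simp: cubic_graph_def simple_graph_def)

lemma edge_neq: "{x, y} \<in> edges B \<Longrightarrow> x \<noteq> y"
  using cubic by (fastforce simp: cubic_graph_def simple_graph_def)

lemma face_in: "{x, y} \<in> edges B \<Longrightarrow> face x y \<in> A x"
  using bij_betwE[OF face_bij[of x]] edge_verts[of x y] by (auto simp: neighbours_def)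

lemma face_eqD: "{x, y} \<in> edges B \<Longrightarrow> {x, z} \<in> edges B \<Longrightarrow> face x y = face x z \<Longrightarrow> y = z"
  using bij_betw_imp_inj_on[OF face_bij[of x]] edge_verts[of x y]
  by (auto simp: neighbours_def dest: inj_onD)

lemma card_A: "x \<in> verts B \<Longrightarrow> card (A x) = 3"
  using gadget by (simp add: vertex_gadget_def)

lemma verts_G: "(x, u) \<in> verts G \<longleftrightarrow> x \<in> verts B \<and> u \<in> verts (H x)"
  by (auto simp: G_def replace_vertices_def)

text \<open>Comparing first components decides the type of an edge. Since \<open>B\<close> has no
  loops, an edge joining two attachments across an edge of \<open>B\<close> never stays in one copy,
  so the two cases exclude each other.\<close>

lemma edges_G:
  "{(x, u), (y, v)} \<in> edges G \<longleftrightarrow>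
    (if x = y then x \<in> verts B \<and> {u, v} \<in> edges (H x)
     else {x, y} \<in> edges B \<and> u = face x y \<and> v = face y x)"
proof -
  have inside: "{(x, u), (y, v)} \<in> edges (gadget_copy z (H z)) \<longleftrightarrow>
    x = z \<and> y = z \<and> {u, v} \<in> edges (H z)" for z
  proof (cases "x = z \<and> y = z")
    case True
    then show ?thesis by (simp del: gadget_copy_simps)
  next
    case False
    then show ?thesis by (auto simp: set_eq_iff image_iff)
  qed
  have across: "(\<exists>x' y'. {(x, u), (y, v)} = {(x', face x' y'), (y', face y' x')} \<and> {x', y'} \<in> edges B)
    \<longleftrightarrow> {x, y} \<in> edges B \<and> u = face x y \<and> v = face y x"
    by (auto simp: doubleton_eq_iff insert_commute)
  have "{(x, u), (y, v)} \<in> edges G \<longleftrightarrow>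
    (\<exists>z\<in>verts B. {(x, u), (y, v)} \<in> edges (gadget_copy z (H z))) \<or>
    (\<exists>x' y'. {(x, u), (y, v)} = {(x', face x' y'), (y', face y' x')} \<and> {x', y'} \<in> edges B)"
    by (simp add: G_def replace_vertices_def del: gadget_copy_simps)
  then show ?thesis
    unfolding inside across using edge_neq[of x y] by auto
qed

section \<open>Cycles inside one gadget copy\<close>

lemma is_cycle_of_gadget_copy:
  assumes "x \<in> verts B" "is_cycle (gadget_copy x (H x)) c"
  shows "is_cycle G c"
  using assms unfolding is_cycle_def G_def replace_vertices_def
  by (auto simp del: gadget_copy_simps cycle_graph_simps)

text \<open>Constancy of \<open>fst\<close> along the cyclic pairs puts all vertices into the copy
  of \<open>hd c\<close>, and within one copy \<open>edges_G\<close> leaves only gadget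
  edges.\<close>

lemma is_cycle_gadget_copyI:
  assumes c: "is_cycle G c" and same: "\<And>p q. (p, q) \<in> cyc_consec c \<Longrightarrow> fst p = fst q"
  shows "\<exists>x\<in>verts B. is_cycle (gadget_copy x (H x)) c"
proof
  let ?x = "fst (hd c)"
  have const: "fst p = ?x" if "p \<in> set c" for p
    using cyc_consec_const[of c fst] same that by blast
  have "c \<noteq> []" using c by (auto simp: is_cycle_iff)
  then have "hd c \<in> verts G" using c hd_in_set unfolding is_cycle_iff by blast
  then show "?x \<in> verts B" by (metis prod.collapse verts_G)
  have "set c \<subseteq> verts (gadget_copy ?x (H ?x))"
    using c const verts_G by (fastforce simp: is_cycle_iff image_iff)
  moreover have "{p, q} \<in> edges (gadget_copy ?x (H ?x))" if pq: "(p, q) \<in> cyc_consec c" for p q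
  proof -
    have "p \<in> set c" "q \<in> set c" using pq cyc_consec_subset[of c] by auto
    then obtain u v where "p = (?x, u)" "q = (?x, v)"
      using const by (metis prod.collapse)
    moreover have "{p, q} \<in> edges G" using c pq unfolding is_cycle_iff by blast
    ultimately have "{u, v} \<in> edges (H ?x)" using edges_G[of ?x u ?x v] by simp
    then show ?thesis
      using Pair_edge_in_gadget_copy[of ?x u v] \<open>p = _\<close> \<open>q = _\<close> by metis
  qed
  ultimately show "is_cycle (gadget_copy ?x (H ?x)) c"
    using c unfolding is_cycle_iff by blast
qed

section \<open>From cycles of \<open>G\<close> to cycles of \<open>B\<close>\<close>

lemma cycle_projects:
  assumes c: "is_cycle G c" and pq: "(p, q) \<in> cyc_consec c" "fst p \<noteq> fst q"
  shows "\<exists>xs s. is_cycle B xs \<and> projection (cycle_graph c) = cycle_graph xs \<and>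
    (\<forall>i<length xs. s i \<in> traversal_lengths H face xs i) \<and>
    length c = length xs + (\<Sum>i<length xs. s i)"
proof -
  obtain k where k: "k < length c" "p = c ! k" "q = c ! (Suc k mod length c)"
    using pq(1) by (auto simp: cyc_consec_conv_nth)
  \<comment> \<open>Rotating by \<open>Suc k\<close> puts \<open>q\<close> first and
    \<open>p\<close> last, so the cycle is cut open at an edge between different copies.\<close>
  define c' where "c' = rotate (Suc k) c"
  have c': "is_cycle G c'" "cycle_graph c' = cycle_graph c" "length c' = length c"
    using c by (simp_all only: c'_def is_cycle_rotate cycle_graph_rotate length_rotate)
  have dist: "distinct c'" and len: "length c' \<ge> 3" and vs: "set c' \<subseteq> verts G"
    and es: "\<And>a b. (a, b) \<in> cyc_consec c' \<Longrightarrow> {a, b} \<in> edges G"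
    using c'(1) by (auto simp: is_cycle_iff)
  have "c' \<noteq> []" using len by auto
  have hd: "hd c' = q"
    using \<open>c' \<noteq> []\<close> k by (simp add: c'_def hd_rotate_conv_nth del: rotate_Suc)
  have "last c' = c' ! (length c - 1)" using \<open>c' \<noteq> []\<close> c'(3) by (simp add: last_conv_nth)
  also have "\<dots> = c ! ((Suc k + (length c - 1)) mod length c)"
    unfolding c'_def using k by (intro nth_rotate) simp
  also have "Suc k + (length c - 1) = k + length c" using k by simp
  finally have last: "last c' = p" using k by simp
  obtain cs where cs: "concat cs = c'" "\<And>b. b \<in> set cs \<Longrightarrow> b \<noteq> []"
    and const: "\<And>b p. b \<in> set cs \<Longrightarrow> p \<in> set b \<Longrightarrow> fst p = fst (hd b)"
    and change': "\<And>b d. (b, d) \<in> consec cs \<Longrightarrow> fst (last b) \<noteq> fst (hd d)"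
    by (rule split_into_blocks[of c' fst]) blast
  have "cs \<noteq> []" using cs \<open>c' \<noteq> []\<close> by auto
  \<comment> \<open>Compared with \<open>change'\<close>, only the pair of the last and the first
    block is new; its junction is the edge from \<open>p\<close> to \<open>q\<close> at which the
    cycle was cut.\<close>
  have change: "fst (last b) \<noteq> fst (hd d)" if "(b, d) \<in> cyc_consec cs" for b d
  proof -
    have "last (last cs) = p" "hd (hd cs) = q"
      using hd last cs \<open>cs \<noteq> []\<close> hd_concat[of cs] last_concat[of cs] by simp_all
    then show ?thesis using that change' pq(2) \<open>cs \<noteq> []\<close> by (auto simp: cyc_consec_conv_consec)
  qed
  have cyc_c': "cyc_consec c' =
    (\<Union>b\<in>set cs. consec b) \<union> (\<lambda>(b, d). (last b, hd d)) ` cyc_consec cs"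
    using cyc_consec_concat[of cs] cs \<open>cs \<noteq> []\<close> by blast
  have inner: "consec b \<subseteq> cyc_consec c'" if "b \<in> set cs" for b
    using that cyc_c' by blast
  have outer: "(last b, hd d) \<in> cyc_consec c'" if "(b, d) \<in> cyc_consec cs" for b d
    unfolding cyc_c' using that by (intro UnI2 image_eqI[of _ _ "(b, d)"]) simp_all
  define g where "g b = fst (hd b)" for b :: "('a \<times> 'b) list"
  have fst_g: "fst r = g b" if "b \<in> set cs" "r \<in> set b" for b r
    using const[OF that] by (simp add: g_def)
  \<comment> \<open>A junction changes the copy, so by \<open>edges_G\<close> it runs along an edge
    of \<open>B\<close>, and its ends are the two attachments facing each other.\<close>
  have link: "{g b, g d} \<in> edges B \<and> last b = (g b, face (g b) (g d)) \<and>
    hd d = (g d, face (g d) (g b))" if bd: "(b, d) \<in> cyc_consec cs" for b d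
  proof -
    have mem: "b \<in> set cs" "d \<in> set cs" using bd cyc_consec_subset by blast+
    have "{last b, hd d} \<in> edges G" by (rule es[OF outer[OF bd]])
    moreover have "fst (last b) = g b" "fst (hd d) = g d"
      using fst_g mem cs(2) by auto
    moreover have "g b \<noteq> g d" using change[OF bd] calculation by simp
    moreover obtain u v where "last b = (fst (last b), u)" "hd d = (fst (hd d), v)"
      by (metis prod.collapse)
    ultimately show ?thesis using edges_G[of "g b" u "g d" v] by auto
  qed
  have prev: "\<exists>a. (a, b) \<in> cyc_consec cs" and succ: "\<exists>d. (b, d) \<in> cyc_consec cs"
    if "b \<in> set cs" for b
    using that by (metis in_set_conv_nth cyc_consec_prev, metis in_set_conv_nth cyc_consec_next)
  have ends: "hd b \<noteq> last b \<and> {hd b, last b} \<subseteq> Pair (g b) ` A (g b) \<and> g b \<in> verts B"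
    if b: "b \<in> set cs" for b
  proof -
    obtain a d where a: "(a, b) \<in> cyc_consec cs" and d: "(b, d) \<in> cyc_consec cs"
      using prev succ b by blast
    have "hd b \<noteq> last b"
    proof
      \<comment> \<open>Entering and leaving by the same attachment means that both junctions run
        along the same edge of \<open>B\<close>, by injectivity of \<open>face\<close>. Then
        \<open>last a\<close> and \<open>hd d\<close> are the same attachment of the neighbouring
        copy, and the cycle turns back at \<open>hd b\<close>.\<close>
      assume eq: "hd b = last b"
      have "(last a, hd b) \<in> cyc_consec c'" "(hd b, hd d) \<in> cyc_consec c'"
        using outer[OF a] outer[OF d] eq by simp_all
      then have "last a \<noteq> hd d" using cyc_consec_no_return dist len by metis
      moreover have "g a = g d"
        using link[OF a] link[OF d] eq face_eqD[of "g b" "g a" "g d"] by (simp add: insert_commute)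
      ultimately show False using link[OF a] link[OF d] by simp
    qed
    moreover have "{g b, g a} \<in> edges B" using link[OF a] by (simp add: insert_commute)
    ultimately show ?thesis
      using link[OF a] link[OF d] face_in[of "g b"] edge_verts[of "g b"] by auto
  qed
  have disj: "set (cs ! i) \<inter> set (cs ! j) = {}" if "i < length cs" "j < length cs" "i \<noteq> j" for i j
  proof -
    have "distinct (concat cs)" "[] \<notin> set cs" using dist cs by auto
    \<comment> \<open>Distinctness of a concatenation says nothing about repeated empty blocks,
      hence the fact that there are none.\<close>
    then have "distinct cs"
      by (simp add: distinct_concat_iff removeAll_id)
    then have "cs ! i \<noteq> cs ! j" using that by (simp add: nth_eq_iff_index_eq)
    then show ?thesis using \<open>distinct (concat cs)\<close> that by (auto simp: distinct_concat_iff)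
  qed
  define xs where "xs = map g cs"
  have lxs: "length xs = length cs" by (simp add: xs_def)
  have dxs: "distinct xs"
    unfolding distinct_conv_nth
  proof (intro allI impI notI)
    fix i j assume ij: "i < length xs" "j < length xs" "i \<noteq> j" "xs ! i = xs ! j"
    let ?b = "cs ! i" and ?d = "cs ! j"
    have mem: "?b \<in> set cs" "?d \<in> set cs" and gd: "g ?d = g ?b"
      using ij by (simp_all add: xs_def)
    have "{hd ?b, last ?b} \<subseteq> set ?b" "{hd ?d, last ?d} \<subseteq> set ?d"
      using cs(2)[OF mem(1)] cs(2)[OF mem(2)] by simp_all
    moreover have "set ?b \<inter> set ?d = {}" using disj[of i j] ij lxs by simp
    ultimately have "{hd ?b, last ?b} \<inter> {hd ?d, last ?d} = {}" by blast
    then have "card {hd ?b, last ?b, hd ?d, last ?d} = 4"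
      using ends[OF mem(1)] ends[OF mem(2)] by (auto simp: card_insert_if)
    moreover have A: "card (A (g ?b)) = 3" using ends[OF mem(1)] card_A by blast
    \<comment> \<open>Finiteness of \<open>A (g ?b)\<close> follows from its nonzero cardinality;
      \<open>card_mono\<close> needs it for the contradiction between four ends and three
      attachments.\<close>
    then have "finite (Pair (g ?b) ` A (g ?b))" by (intro finite_imageI card_ge_0_finite) simp
    then have "card {hd ?b, last ?b, hd ?d, last ?d} \<le> card (Pair (g ?b) ` A (g ?b))"
      using ends[OF mem(1)] ends[OF mem(2)] unfolding gd by (intro card_mono) simp_all
    moreover have "card (Pair (g ?b) ` A (g ?b)) = 3" using A by (simp add: card_image inj_on_def)
    ultimately show False by simp
  qed
  have cyc_xs: "cyc_consec xs = map_prod g g ` cyc_consec cs"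
    by (simp add: xs_def cyc_consec_map)
  \<comment> \<open>A single block would have to change copy at its own junction, although
    \<open>fst\<close> is constant on it. With two blocks both junctions run along the same edge of
    \<open>B\<close>, so \<open>hd b\<close> and \<open>last b\<close> would be the same attachment,
    against \<open>ends\<close>.\<close>
  have "length cs \<ge> 3"
  proof (rule ccontr)
    assume "\<not> length cs \<ge> 3"
    moreover have "length cs \<noteq> 0" using \<open>cs \<noteq> []\<close> by simp
    ultimately have "length cs = 1 \<or> length cs = 2" by linarith
    then consider b where "cs = [b]" | b d where "cs = [b, d]"
      by (auto simp: length_Suc_conv numeral_2_eq_2)
    then show False
    proof cases
      case (1 b)
      then show False using change[of b b] const[of b "last b"] cs(2)[of b]
        by (simp add: cyc_consec_def)
    next
      case (2 b d)
      then have "(b, d) \<in> cyc_consec cs" "(d, b) \<in> cyc_consec cs" by (auto simp: cyc_consec_def)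
      then show False using link[of b d] link[of d b] ends[of b] 2 by simp
    qed
  qed
  then have cycle: "is_cycle B xs"
    using ends link dxs by (auto simp: is_cycle_iff lxs cyc_xs) (auto simp: xs_def)
  have proj: "projection (cycle_graph c) = cycle_graph xs"
  proof (rule graph.equality)
    have "set xs = fst ` set c'"
    proof
      show "set xs \<subseteq> fst ` set c'"
        unfolding xs_def g_def using cs by (fastforce simp flip: cs(1))
      show "fst ` set c' \<subseteq> set xs"
        unfolding xs_def using fst_g by (auto simp flip: cs(1))
    qed
    then show "verts (projection (cycle_graph c)) = verts (cycle_graph xs)"
      by (simp add: projection_def flip: c'(2))
    have same: "fst p = fst q" if "b \<in> set cs" "(p, q) \<in> consec b" for b p q
      using const[OF that(1)] that(2) consec_subset[of b] by (metis SigmaD1 SigmaD2 subsetD)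
    have "edges (projection (cycle_graph c)) =
      {{fst p, fst q} | p q. (p, q) \<in> cyc_consec c' \<and> fst p \<noteq> fst q}"
      unfolding c'(2)[symmetric] by (rule edges_projection_cycle_graph)
    also have "\<dots> = (\<lambda>(b, d). {fst (last b), fst (hd d)}) ` cyc_consec cs"
    proof -
      \<comment> \<open>Pairs within a block keep the first component and junctions change it, so
        exactly the junctions survive the contraction.\<close>
      have "(p, q) \<in> cyc_consec c' \<and> fst p \<noteq> fst q \<longleftrightarrow>
        (\<exists>b d. p = last b \<and> q = hd d \<and> (b, d) \<in> cyc_consec cs)" for p q
        unfolding cyc_c' by (auto dest: change same)
      then show ?thesis by (simp only:) (auto simp: image_iff simp del: split_paired_Ex; blast)
    qed
    also have "\<dots> = (\<lambda>(b, d). {g b, g d}) ` cyc_consec cs"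
      by (intro image_cong) (auto dest: link)
    also have "\<dots> = (\<lambda>(a, b). {a, b}) ` cyc_consec xs"
      by (simp add: cyc_xs image_image case_prod_beta)
    finally show "edges (projection (cycle_graph c)) = edges (cycle_graph xs)"
      by simp
  qed simp
  \<comment> \<open>A block with n vertices is a path with n - 1 edges. Blocks are nonempty, so the
    subtraction is exact, and the 1 lost per block accounts for the \<open>length xs\<close>
    junction edges.\<close>
  define s where "s i = length (cs ! i) - 1" for i
  have trav: "s i \<in> traversal_lengths H face xs i" if i: "i < length xs" for i
  proof -
    let ?b = "cs ! i" and ?l = "length cs"
    let ?a = "cs ! ((i + ?l - 1) mod ?l)" and ?d = "cs ! ((i + 1) mod ?l)"
    have i': "i < ?l" using i lxs by simp
    have b: "?b \<in> set cs" using i' by simp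
    have ln: "0 < ?l" using i' by linarith
    have ga: "xs ! ((i + ?l - 1) mod ?l) = g ?a" "xs ! ((i + 1) mod ?l) = g ?d" "xs ! i = g ?b"
      using i' mod_less_divisor[OF ln] unfolding xs_def by (simp_all only: nth_map)
    have a: "(?a, ?b) \<in> cyc_consec cs" and d: "(?b, ?d) \<in> cyc_consec cs"
      using cyc_consec_prev[OF i'] cyc_consec_next[OF i'] by simp_all
    \<comment> \<open>As \<open>fst\<close> is constant on the block, the second components
      determine it; this carries distinctness, vertices and edges over to the gadget.\<close>
    have b_eq: "?b = map (Pair (g ?b)) (map snd ?b)"
      using fst_g[OF b] by (simp add: map_idI prod_eq_iff comp_def)
    have "is_path (H (g ?b)) (face (g ?b) (g ?a)) (map snd ?b) (face (g ?b) (g ?d))"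
      unfolding is_path_iff
    proof (intro conjI allI impI)
      show "map snd ?b \<noteq> []" using cs(2)[OF b] by simp
      show "hd (map snd ?b) = face (g ?b) (g ?a)" "last (map snd ?b) = face (g ?b) (g ?d)"
        using link[OF a] link[OF d] cs(2)[OF b] by (simp_all add: hd_map last_map)
      have "distinct ?b" using dist b by (auto simp: distinct_concat_iff simp flip: cs(1))
      then show "distinct (map snd ?b)" by (metis b_eq distinct_map)
      show "set (map snd ?b) \<subseteq> verts (H (g ?b))"
      proof
        fix u assume "u \<in> set (map snd ?b)"
        then have "(g ?b, u) \<in> set ?b" using b_eq by (metis (no_types) image_eqI list.set_map)
        then show "u \<in> verts (H (g ?b))" using vs b verts_G by (auto simp flip: cs(1))
      qed
      fix u v assume "(u, v) \<in> consec (map snd ?b)"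
      then have "((g ?b, u), (g ?b, v)) \<in> consec ?b"
        by (subst b_eq) (force simp only: consec_map map_prod_simp)
      then have "{(g ?b, u), (g ?b, v)} \<in> edges G" using es inner[OF b] by blast
      then show "{u, v} \<in> edges (H (g ?b))" by (simp add: edges_G)
    qed
    then have "s i \<in> path_lengths (H (g ?b)) (face (g ?b) (g ?a)) (face (g ?b) (g ?d))"
      unfolding path_lengths_def s_def by (intro CollectI exI[of _ "map snd ?b"]) simp
    then show ?thesis by (simp only: traversal_lengths_def Let_def lxs ga)
  qed
  have "length c = (\<Sum>i<length cs. length (cs ! i))"
    unfolding c'(3)[symmetric] cs(1)[symmetric]
    by (simp add: length_concat sum_list_sum_nth atLeast0LessThan)
  also have "\<dots> = (\<Sum>i<length cs. Suc (s i))"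
    using cs(2) by (intro sum.cong) (auto simp: s_def)
  finally have "length c = length xs + (\<Sum>i<length xs. s i)" by (simp add: lxs sum_Suc)
  then show ?thesis using cycle proj trav by blast
qed

section \<open>From cycles of \<open>B\<close> to cycles of \<open>G\<close>\<close>

lemma cycle_lifts:
  assumes xs: "is_cycle B xs" and s: "\<And>i. i < length xs \<Longrightarrow> s i \<in> traversal_lengths H face xs i"
  shows "\<exists>c. is_cycle G c \<and> length c = length xs + (\<Sum>i<length xs. s i)"
proof -
  let ?l = "length xs"
  let ?p = "\<lambda>i. face (xs ! i) (xs ! ((i + ?l - 1) mod ?l))"
  let ?q = "\<lambda>i. face (xs ! i) (xs ! ((i + 1) mod ?l))"
  have "\<exists>ps. is_path (H (xs ! i)) (?p i) ps (?q i) \<and> s i = length ps - 1" if "i < ?l" for i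
    using s[OF that] by (auto simp: traversal_lengths_def Let_def path_lengths_def)
  then obtain ps where path: "\<And>i. i < ?l \<Longrightarrow> is_path (H (xs ! i)) (?p i) (ps i) (?q i)"
    and s_eq: "\<And>i. i < ?l \<Longrightarrow> s i = length (ps i) - 1"
    by metis
  define blk where "blk i = map (Pair (xs ! i)) (ps i)" for i
  define cs where "cs = map blk [0..<?l]"
  have l: "?l \<ge> 3" and dxs: "distinct xs" and vxs: "set xs \<subseteq> verts B"
    and exs: "\<And>a b. (a, b) \<in> cyc_consec xs \<Longrightarrow> {a, b} \<in> edges B"
    using xs by (auto simp: is_cycle_iff)
  have lcs: "length cs = ?l" and nth_cs: "\<And>i. i < ?l \<Longrightarrow> cs ! i = blk i"
    by (simp_all add: cs_def)
  have set_cs: "set cs = blk ` {..<?l}" by (auto simp: cs_def)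
  have ne: "blk i \<noteq> []" if "i < ?l" for i using path[OF that] by (simp add: blk_def is_path_iff)
  have "cs \<noteq> []" using lcs l by auto
  have ne_cs: "\<And>b. b \<in> set cs \<Longrightarrow> b \<noteq> []" using ne set_cs by auto
  have len: "length (concat cs) = ?l + (\<Sum>i<?l. s i)"
  proof -
    have "length (concat cs) = (\<Sum>i<?l. length (blk i))"
      by (simp add: cs_def length_concat sum_list_sum_nth atLeast0LessThan comp_def)
    also have "\<dots> = (\<Sum>i<?l. Suc (s i))"
      using path s_eq by (intro sum.cong) (auto simp: blk_def is_path_iff)
    finally show ?thesis by (simp add: sum_Suc)
  qed
  have fst_blk: "fst r = xs ! i" if "r \<in> set (blk i)" for r i
    using that by (auto simp: blk_def)
  \<comment> \<open>The blocks at different positions lie in copies of different vertices, because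
    \<open>xs\<close> is distinct.\<close>
  have disj: "set (blk i) \<inter> set (blk j) = {}" if "i < ?l" "j < ?l" "i \<noteq> j" for i j
    using fst_blk[of _ i] fst_blk[of _ j] that dxs
    by (metis disjoint_iff nth_eq_iff_index_eq)
  have "distinct cs"
    unfolding cs_def distinct_map
  proof (intro conjI inj_onI)
    fix i j assume "i \<in> set [0..<?l]" "j \<in> set [0..<?l]" "blk i = blk j"
    then show "i = j" using disj[of i j] ne[of i] by auto
  qed simp
  moreover have "distinct b" if "b \<in> set cs" for b
    using that path by (auto simp: set_cs blk_def distinct_map inj_on_def is_path_iff)
  ultimately have dist: "distinct (concat cs)"
    using disj by (intro distinct_concat) (auto simp: set_cs)
  have vs: "set (concat cs) \<subseteq> verts G"
    using path vxs by (fastforce simp: set_cs blk_def is_path_iff verts_G)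
  have es: "{a, b} \<in> edges G" if ab: "(a, b) \<in> cyc_consec (concat cs)" for a b
  proof -
    have modl: "Suc i mod ?l < ?l" for i using l by (intro mod_less_divisor) linarith
    have "(a, b) \<in> (\<Union>b\<in>set cs. consec b) \<union> (\<lambda>(b, d). (last b, hd d)) ` cyc_consec cs"
      using ab cyc_consec_concat[OF ne_cs \<open>cs \<noteq> []\<close>] by blast
    then consider (inner) i where "i < ?l" "(a, b) \<in> consec (blk i)"
      | (outer) i where "i < ?l" "a = last (blk i)" "b = hd (blk (Suc i mod ?l))"
      by (auto simp: set_cs cyc_consec_conv_nth lcs nth_cs modl)
    then show ?thesis
    proof cases
      case inner
      then obtain u v where uv: "a = (xs ! i, u)" "b = (xs ! i, v)" "(u, v) \<in> consec (ps i)"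
        by (auto simp: blk_def consec_map)
      then have "{u, v} \<in> edges (H (xs ! i))" using path[OF inner(1)] by (simp add: is_path_iff)
      then show ?thesis using uv edges_G[of "xs ! i" u "xs ! i" v] vxs inner(1) by auto
    next
      case outer
      let ?j = "Suc i mod ?l"
      have j: "?j < ?l" by (rule modl)
      \<comment> \<open>The cyclic predecessor of \<open>?j\<close> is \<open>i\<close>, so the path
        of block \<open>?j\<close> starts at the attachment facing \<open>xs ! i\<close>, just where
        the edge from block \<open>i\<close> arrives. The case distinction isolates the
        wrap-around.\<close>
      have "(?j + ?l - 1) mod ?l = i"
        using outer(1) l by (cases "Suc i = ?l") auto
      then have "b = (xs ! ?j, face (xs ! ?j) (xs ! i))"
        using outer path[OF j] by (simp add: blk_def is_path_iff hd_map)
      moreover have "a = (xs ! i, face (xs ! i) (xs ! ?j))"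
        using outer path[OF outer(1)] by (simp add: blk_def is_path_iff last_map)
      moreover have e: "{xs ! i, xs ! ?j} \<in> edges B"
        using exs cyc_consec_next[OF outer(1)] by simp
      ultimately show ?thesis using edge_neq[OF e] by (simp add: edges_G)
    qed
  qed
  have "is_cycle G (concat cs)" using len l dist vs es by (simp add: is_cycle_iff)
  then show ?thesis using len by blast
qed

end

text \<open>An element of a sum of sets is a sum over a choice function. Working in the integers
  avoids truncation of \<open>T - l\<close>: for T < l the difference is negative, while all sums
  are nonnegative, so both sides fail.\<close>

lemma int_mem_sum_image_iff:
  fixes n :: nat
  shows "int T - int l \<in> (\<Sum>i<n. int ` S i) \<longleftrightarrow> (\<exists>s. (\<forall>i<n. s i \<in> S i) \<and> T = l + (\<Sum>i<n. s i))"
proof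
  assume "int T - int l \<in> (\<Sum>i<n. int ` S i)"
  then obtain t where t: "int T - int l = (\<Sum>i<n. t i)" "\<And>i. i < n \<Longrightarrow> t i \<in> int ` S i"
    unfolding set_sum_alt[OF finite_lessThan] by blast
  \<comment> \<open>Each \<open>t i\<close> is the image of a natural number, so \<open>nat\<close>
    recovers it without loss.\<close>
  define s where "s i = nat (t i)" for i
  have s: "s i \<in> S i \<and> t i = int (s i)" if "i < n" for i
    using t(2)[OF that] by (auto simp: s_def)
  then have "(\<Sum>i<n. t i) = int (\<Sum>i<n. s i)" by simp
  then have "T = l + (\<Sum>i<n. s i)" using t(1) by linarith
  then show "\<exists>s. (\<forall>i<n. s i \<in> S i) \<and> T = l + (\<Sum>i<n. s i)" using s by blast
next
  assume "\<exists>s. (\<forall>i<n. s i \<in> S i) \<and> T = l + (\<Sum>i<n. s i)"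
  then obtain s where s: "\<forall>i<n. s i \<in> S i" "T = l + (\<Sum>i<n. s i)" by blast
  then have "int T - int l = (\<Sum>i<n. int (s i))" by simp
  with s(1) show "int T - int l \<in> (\<Sum>i<n. int ` S i)"
    by (auto simp: set_sum_alt intro!: exI[of _ "\<lambda>i. int (s i)"])
qed

theorem lemma3p2:
  fixes B :: "'a graph"
    and H :: "'a \<Rightarrow> 'b graph"
    and A :: "'a \<Rightarrow> 'b set"
    and face :: "'a \<Rightarrow> 'a \<Rightarrow> 'b"
    and G :: "('a \<times> 'b) graph"
  assumes "cubic_graph B"
    and "\<And>x. x \<in> verts B \<Longrightarrow> vertex_gadget (H x) (A x)"
    and "\<And>x. x \<in> verts B \<Longrightarrow> bij_betw (face x) (neighbours B x) (A x)"
    and "G = replace_vertices B H face"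
  shows "(\<forall>c. is_cycle G c \<longrightarrow>
            (\<exists>x\<in>verts B. is_cycle (gadget_copy x (H x)) c) \<or>
            (\<exists>xs s. is_cycle B xs \<and>
               projection (cycle_graph c) = cycle_graph xs \<and>
               (\<forall>i<length xs. s i \<in> traversal_lengths H face xs i) \<and>
               length c = length xs + (\<Sum>i<length xs. s i)))
       \<and> (\<forall>xs s. is_cycle B xs \<and> (\<forall>i<length xs. s i \<in> traversal_lengths H face xs i) \<longrightarrow>
            (\<exists>c. is_cycle G c \<and> length c = length xs + (\<Sum>i<length xs. s i)))
       \<and> (\<forall>T::nat. (\<exists>c. is_cycle G c \<and> length c = T) \<longleftrightarrow>
            (\<exists>x\<in>verts B. \<exists>c. is_cycle (H x) c \<and> length c = T) \<or>
            (\<exists>xs. is_cycle B xs \<and>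
               int T - int (length xs) \<in> (\<Sum>i<length xs. int ` traversal_lengths H face xs i)))"
proof -
  interpret replacement B H A face G
    by unfold_locales (use assms in auto)
  have forward: "(\<exists>x\<in>verts B. is_cycle (gadget_copy x (H x)) c) \<or>
    (\<exists>xs s. is_cycle B xs \<and> projection (cycle_graph c) = cycle_graph xs \<and>
      (\<forall>i<length xs. s i \<in> traversal_lengths H face xs i) \<and>
      length c = length xs + (\<Sum>i<length xs. s i))" if c: "is_cycle G c" for c
  \<comment> \<open>The dichotomy is whether some edge of the cycle joins different copies.\<close>
  proof (cases "\<forall>(p, q)\<in>cyc_consec c. fst p = fst q")
    case True
    then show ?thesis using is_cycle_gadget_copyI[OF c] by blast
  next
    case False
    then obtain p q where "(p, q) \<in> cyc_consec c" "fst p \<noteq> fst q" by blast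
    then show ?thesis using cycle_projects[OF c] by blast
  qed
  have "(\<exists>c. is_cycle G c \<and> length c = T) \<longleftrightarrow>
    (\<exists>x\<in>verts B. \<exists>c. is_cycle (H x) c \<and> length c = T) \<or>
    (\<exists>xs. is_cycle B xs \<and>
      int T - int (length xs) \<in> (\<Sum>i<length xs. int ` traversal_lengths H face xs i))" for T
  proof -
    \<comment> \<open>For lengths alone the projection can be forgotten, and the two directions
      above, with the cycles of the copies, give the equivalence. It remains to pass from copies to
      gadgets and from choices \<open>s\<close> to the Minkowski sum.\<close>
    have "(\<exists>c. is_cycle G c \<and> length c = T) \<longleftrightarrow>
      (\<exists>x\<in>verts B. \<exists>c. is_cycle (gadget_copy x (H x)) c \<and> length c = T) \<or>
      (\<exists>xs s. is_cycle B xs \<and> (\<forall>i<length xs. s i \<in> traversal_lengths H face xs i) \<and>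
        T = length xs + (\<Sum>i<length xs. s i))"
      using forward cycle_lifts is_cycle_of_gadget_copy by metis
    then show ?thesis unfolding int_mem_sum_image_iff ex_is_cycle_gadget_copy by blast
  qed
  then show ?thesis using forward cycle_lifts by (intro conjI allI impI) (assumption | blast)+
qed

end
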